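(* Assume the $P$-ideal dichotomy $\mathsf{PID}$. Then for every Fréchet $\alpha_1$-space $X$, the tightness of its $G_\delta$-modification satisfies $t(X_\delta)\le \omega_1$.
   Context: For a topological space $X$, the $G_\delta$-modification $X_\delta$ is the space with the same underlying set as $X$ and with the $G_\delta$ subsets of $X$ as a base for its topology. Tightness: for a point $x$ of a space $X$, $t(x,X)$ is the minimum cardinal $\kappa$ such that for every $A\subseteq X$ with $x\in\overline{A}$ there is $B\subseteq A$ with $|B|\le\kappa$ and $x\in\overline{B}$. The tightness of $X$ is $t(X)=\sup_{x\in X}t(x,X)$. A point $x\in X$ is Fréchet if for every $A\subseteq X$, $x\in\overline{A}$ if and only if there is a sequence $\{x_n:n<\omega\}\subseteq A$ converging to $x$. A point $x\in X$ is $\alpha_1$ if for every countable collection of sequences converging to $x$ there is another sequence converging to $x$ which, modulo finite sets, contains each of them (sequences are identified with their ranges). The space $X$ is Fréchet (respectively an $\alpha_1$-space) if every point of $X$ is Fréchet (respectively $\alpha_1$); a Fréchet $\alpha_1$-space is one with both properties. A $P$-ideal on a set $S$ is an ideal $\mathcal{I}$ consisting of countable subsets of $S$, containing all finite subsets of $S$, such that for any $\{A_n:n<\omega\}\subseteq\mathcal{I}$ there is $A\in\mathcal{I}$ with $A_n\setminus A$ finite for all $n$. The $P$-ideal dichotomy $\mathsf{PID}$ is the statement that for every set $S$ and every $P$-ideal $\mathcal{I}$ on $S$, either (i) there is an uncountable $Y\subseteq S$ such that every countable subset of $Y$ is in $\mathcal{I}$, or (ii) $S=\bigcup_{n<\omega}Y_n$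 for some sets $Y_n$, each of which contains no infinite subset belonging to $\mathcal{I}$. *)

theory Defs
  imports "HOL-Analysis.Analysis"
begin

unbundle cardinal_syntax

definition Gdelta_modification :: "'a topology \<Rightarrow> 'a topology" where
  "Gdelta_modification X = topology (arbitrary union_of gdelta_in X)"

lemma openin_Gdelta_modification:
  "openin (Gdelta_modification X) = arbitrary union_of gdelta_in X"
  unfolding Gdelta_modification_def
  by (intro topology_inverse' istopology_base) (rule gdelta_in_Int)

lemma topspace_Gdelta_modification: "topspace (Gdelta_modification X) = topspace X"
proof (rule subset_antisym)
  have "S \<subseteq> topspace X" if "(arbitrary union_of gdelta_in X) S" for S
    using that
  proof (unfold union_of_def, elim exE conjE)
    fix \<U> assume "\<U> \<subseteq> Collect (gdelta_in X)" "\<Union>\<U> = S"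
    then show "S \<subseteq> topspace X"
      using gdelta_in_subset[of X] by (auto simp only: mem_Collect_eq subset_iff Union_iff)
  qed
  then show "topspace (Gdelta_modification X) \<subseteq> topspace X"
    using openin_topspace[of "Gdelta_modification X"] by (simp only: openin_Gdelta_modification)
  have "openin (Gdelta_modification X) (topspace X)"
    unfolding openin_Gdelta_modification by (rule arbitrary_union_of_inc) (rule gdelta_in_topspace)
  then show "topspace X \<subseteq> topspace (Gdelta_modification X)"
    by (rule openin_subset)
qed

text \<open>
  Cardinals are represented as in the library: a cardinal is a relation \<open>\<kappa>\<close> with
  \<open>Card_order \<kappa>\<close>, compared by \<open>\<le>o\<close>, so the least cardinal with a given property is
  determined only up to \<open>=o\<close>. The tightness cardinals of a space on the type \<open>'a\<close> do not
  exceed the cardinality of that type, hence it suffices to let \<open>\<kappa>\<close> range over the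
  cardinals on \<open>'a\<close>.
\<close>

definition is_least_card :: "('a rel \<Rightarrow> bool) \<Rightarrow> 'a rel \<Rightarrow> bool" where
  "is_least_card P \<kappa> \<longleftrightarrow>
     Card_order \<kappa> \<and> P \<kappa> \<and> (\<forall>\<kappa>'. Card_order \<kappa>' \<and> P \<kappa>' \<longrightarrow> \<kappa> \<le>o \<kappa>')"

definition least_card :: "('a rel \<Rightarrow> bool) \<Rightarrow> 'a rel" where
  "least_card P = (SOME \<kappa>. is_least_card P \<kappa>)"

lemma is_least_card_least_card:
  assumes "Card_order \<kappa>" "P \<kappa>"
  shows "is_least_card P (least_card P)"
proof -
  let ?R = "{\<kappa>. Card_order \<kappa> \<and> P \<kappa>}"
  have "\<exists>r\<in>?R. \<forall>r'\<in>?R. r \<le>o r'"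
    by (rule exists_minim_Card_order) (use assms in auto)
  then have "\<exists>\<kappa>. is_least_card P \<kappa>"
    unfolding is_least_card_def by blast
  then show ?thesis
    unfolding least_card_def by (rule someI_ex)
qed

definition tight_at :: "'a topology \<Rightarrow> 'a \<Rightarrow> 'a rel \<Rightarrow> bool" where
  "tight_at X x \<kappa> \<longleftrightarrow>
     (\<forall>A. A \<subseteq> topspace X \<and> x \<in> X closure_of A
        \<longrightarrow> (\<exists>B. B \<subseteq> A \<and> |B| \<le>o \<kappa> \<and> x \<in> X closure_of B))"

definition point_tightness :: "'a topology \<Rightarrow> 'a \<Rightarrow> 'a rel" where
  "point_tightness X x = least_card (tight_at X x)"

definition tightness :: "'a topology \<Rightarrow> 'a rel" where
  "tightness X = least_card (\<lambda>\<kappa>. \<forall>x\<in>topspace X. point_tightness X x \<le>o \<kappa>)"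

lemma tight_at_UNIV: "tight_at X x |UNIV :: 'a set|"
  for X :: "'a topology"
  unfolding tight_at_def
proof (intro allI impI)
  fix A assume "A \<subseteq> topspace X \<and> x \<in> X closure_of A"
  then show "\<exists>B. B \<subseteq> A \<and> |B| \<le>o |UNIV :: 'a set| \<and> x \<in> X closure_of B"
    by (intro exI[of _ A]) (simp add: card_of_mono1)
qed

lemma point_tightness_least: "is_least_card (tight_at X x) (point_tightness X x)"
  unfolding point_tightness_def
  by (rule is_least_card_least_card[where P = "tight_at X x", OF card_of_Card_order tight_at_UNIV])

lemma tightness_least:
  "is_least_card (\<lambda>\<kappa>. \<forall>x\<in>topspace X. point_tightness X x \<le>o \<kappa>) (tightness X)"
  unfolding tightness_def
proof (rule is_least_card_least_card[OF card_of_Card_order], rule ballI)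
  fix x
  have "\<forall>\<kappa>. Card_order \<kappa> \<and> tight_at X x \<kappa> \<longrightarrow> point_tightness X x \<le>o \<kappa>"
    using point_tightness_least[of X x] by (simp add: is_least_card_def)
  from this[rule_format, OF conjI, OF card_of_Card_order tight_at_UNIV]
  show "point_tightness X x \<le>o |UNIV :: 'a set|" .
qed

definition convergent_to :: "'a topology \<Rightarrow> (nat \<Rightarrow> 'a) \<Rightarrow> 'a \<Rightarrow> bool" where
  "convergent_to X s x \<longleftrightarrow> range s \<subseteq> topspace X \<and> limitin X s x sequentially"

definition Frechet_at :: "'a topology \<Rightarrow> 'a \<Rightarrow> bool" where
  "Frechet_at X x \<longleftrightarrow>
     (\<forall>A. A \<subseteq> topspace X \<longrightarrow>
        (x \<in> X closure_of A \<longleftrightarrow> (\<exists>s. range s \<subseteq> A \<and> convergent_to X s x)))"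

definition alpha1_at :: "'a topology \<Rightarrow> 'a \<Rightarrow> bool" where
  "alpha1_at X x \<longleftrightarrow>
     (\<forall>\<S>. countable \<S> \<and> (\<forall>s\<in>\<S>. convergent_to X s x) \<longrightarrow>
        (\<exists>t. convergent_to X t x \<and> (\<forall>s\<in>\<S>. finite (range s - range t))))"

definition Frechet_space :: "'a topology \<Rightarrow> bool" where
  "Frechet_space X \<longleftrightarrow> (\<forall>x\<in>topspace X. Frechet_at X x)"

definition alpha1_space :: "'a topology \<Rightarrow> bool" where
  "alpha1_space X \<longleftrightarrow> (\<forall>x\<in>topspace X. alpha1_at X x)"

definition P_ideal :: "'a set \<Rightarrow> 'a set set \<Rightarrow> bool" where
  "P_ideal S \<I> \<longleftrightarrow>
     (\<forall>A\<in>\<I>. A \<subseteq> S \<and> countable A) \<and>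
     (\<forall>F. F \<subseteq> S \<and> finite F \<longrightarrow> F \<in> \<I>) \<and>
     (\<forall>A\<in>\<I>. \<forall>B. B \<subseteq> A \<longrightarrow> B \<in> \<I>) \<and>
     (\<forall>A\<in>\<I>. \<forall>B\<in>\<I>. A \<union> B \<in> \<I>) \<and>
     (\<forall>A :: nat \<Rightarrow> 'a set. range A \<subseteq> \<I> \<longrightarrow> (\<exists>B\<in>\<I>. \<forall>n. finite (A n - B)))"

text \<open>
  A single formula cannot quantify over all types, so the dichotomy is stated for the sets
  of elements of a given type. A bijection transfers it to any set of at most the
  cardinality of that type.
\<close>

definition PID :: "'a itself \<Rightarrow> bool" where
  "PID _ \<longleftrightarrow>
     (\<forall>(S :: 'a set) \<I>. P_ideal S \<I> \<longrightarrow>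
        (\<exists>Y. Y \<subseteq> S \<and> uncountable Y \<and> (\<forall>C. C \<subseteq> Y \<and> countable C \<longrightarrow> C \<in> \<I>)) \<or>
        (\<exists>Y :: nat \<Rightarrow> 'a set. S = (\<Union>n. Y n) \<and>
           (\<forall>n. \<not> (\<exists>Z. Z \<subseteq> Y n \<and> infinite Z \<and> Z \<in> \<I>))))"

abbreviation omega1 :: "nat set rel" where
  "omega1 \<equiv> cardSuc natLeq"

end

(*
  Fix A and a point x in its G_delta-closure. The countable subsets of A that converge to x form a
  P-ideal by alpha_1. If all countable subsets of an uncountable Y converge to x, then every
  neighbourhood of x contains all but finitely many points of Y, so every G_delta set around x
  contains all but countably many of them; hence any subset of Y of size omega_1 accumulates at x in
  the G_delta-modification. If instead A is a union of countably many pieces without infinite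
  convergent subsets, then x lies in the closure of some piece, since otherwise x would have
  a G_delta neighbourhood missing A. By the Frechet property that piece contains a sequence
  converging to x; its range is finite, so some value y is taken infinitely often. As X need not be
  T_1, y may differ from x, but y lies in every neighbourhood of x and {y} already accumulates at x.
*)
theory Submission
  imports Defs
begin

section \<open>Sets converging to a point form a P-ideal\<close>

text \<open>Convergence is phrased for sets rather than sequences: all but finitely many points lie
  in each neighbourhood of \<open>x\<close>. Finite subsets of \<open>A\<close> then belong
  automatically, as a P-ideal demands.\<close>

definition conv_ideal :: "'a topology \<Rightarrow> 'a \<Rightarrow> 'a set \<Rightarrow> 'a set set" where
  "conv_ideal X x A =
     {C. C \<subseteq> A \<and> countable C \<and> (\<forall>U. openin X U \<and> x \<in> U \<longrightarrow> finite (C - U))}"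

lemma finite_range_diff_convergent_to:
  assumes "convergent_to X s x" "openin X U" "x \<in> U"
  shows "finite (range s - U)"
proof -
  have "eventually (\<lambda>n. s n \<in> U) sequentially"
    using assms unfolding convergent_to_def limitin_def by blast
  then obtain N where "\<And>n. n \<ge> N \<Longrightarrow> s n \<in> U"
    unfolding eventually_sequentially by blast
  then have "range s - U \<subseteq> s ` {..<N}"
    by (auto simp: not_less[symmetric])
  then show ?thesis
    by (rule finite_subset) simp
qed

lemma range_Int_in_conv_ideal:
  assumes "convergent_to X s x"
  shows "range s \<inter> A \<in> conv_ideal X x A"
  using finite_range_diff_convergent_to[OF assms]
  by (auto simp: conv_ideal_def Int_Diff intro: finite_subset[of _ "range s - _"])

text \<open>An infinite member of the ideal is enumerated without repetition, so finitely many
  points outside a neighbourhood amount to finitely many indices.\<close>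

lemma convergent_to_from_nat_into:
  assumes "C \<in> conv_ideal X x A" "infinite C" "A \<subseteq> topspace X" "x \<in> topspace X"
  shows "convergent_to X (from_nat_into C) x"
proof -
  have C: "C \<subseteq> A" "countable C" and fin: "\<And>U. openin X U \<Longrightarrow> x \<in> U \<Longrightarrow> finite (C - U)"
    using assms(1) by (auto simp: conv_ideal_def)
  have bij: "bij_betw (from_nat_into C) UNIV C"
    using C assms(2) by (simp add: bij_betw_from_nat_into)
  have "eventually (\<lambda>n. from_nat_into C n \<in> U) sequentially" if U: "openin X U" "x \<in> U" for U
  proof -
    have "finite (from_nat_into C -` (C - U))"
      using fin[OF U] bij by (intro finite_vimageI) (auto simp: bij_betw_def)
    moreover have "{n. from_nat_into C n \<notin> U} \<subseteq> from_nat_into C -` (C - U)"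
      using bij by (auto simp: bij_betw_def)
    ultimately have "finite {n. from_nat_into C n \<notin> U}"
      by (rule rev_finite_subset)
    then show ?thesis
      by (simp add: cofinite_eq_sequentially[symmetric] eventually_cofinite)
  qed
  then show ?thesis
    using bij C assms(3,4) by (auto simp: convergent_to_def limitin_def bij_betw_def)
qed

text \<open>The property \<open>alpha1_at\<close> yields the almost-union: infinite members are
  enumerated as sequences, and the dominating sequence is cut down to \<open>A\<close>, which it may
  leave.\<close>

lemma P_ideal_conv_ideal:
  assumes "alpha1_at X x" "A \<subseteq> topspace X" "x \<in> topspace X"
  shows "P_ideal A (conv_ideal X x A)"
  unfolding P_ideal_def
proof (intro conjI)
  show "\<forall>C :: nat \<Rightarrow> _. range C \<subseteq> conv_ideal X x A \<longrightarrow>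
          (\<exists>B\<in>conv_ideal X x A. \<forall>n. finite (C n - B))"
  proof (intro allI impI)
    fix C :: "nat \<Rightarrow> 'a set"
    assume C: "range C \<subseteq> conv_ideal X x A"
    \<comment> \<open>Finite \<open>C n\<close> are left out: they have no injective enumeration by
      all of \<open>nat\<close>, and they are almost contained in any set.\<close>
    define \<S> where "\<S> = (\<lambda>n. from_nat_into (C n)) ` {n. infinite (C n)}"
    have "countable \<S>"
      by (simp add: \<S>_def)
    moreover have "\<forall>s\<in>\<S>. convergent_to X s x"
      using C assms(2,3) convergent_to_from_nat_into by (fastforce simp: \<S>_def)
    ultimately obtain t where t: "convergent_to X t x" "\<forall>s\<in>\<S>. finite (range s - range t)"
      using assms(1) unfolding alpha1_at_def by blast
    have "finite (C n - range t \<inter> A)" for n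
    proof (cases "finite (C n)")
      case False
      have "C n \<subseteq> A" "countable (C n)"
        using C by (auto simp: conv_ideal_def)
      then have "range (from_nat_into (C n)) = C n"
        using False by (intro range_from_nat_into) auto
      moreover have "finite (range (from_nat_into (C n)) - range t)"
        using t(2) False by (auto simp: \<S>_def)
      moreover have "C n - range t \<inter> A = C n - range t"
        using \<open>C n \<subseteq> A\<close> by blast
      ultimately show ?thesis
        by simp
    qed simp
    then show "\<exists>B\<in>conv_ideal X x A. \<forall>n. finite (C n - B)"
      using range_Int_in_conv_ideal[OF t(1)] by blast
  qed
next
  show "\<forall>C\<in>conv_ideal X x A. \<forall>B. B \<subseteq> C \<longrightarrow> B \<in> conv_ideal X x A"
  proof (intro ballI allI impI)
    fix C B
    assume "C \<in> conv_ideal X x A" and sub: "B \<subseteq> C"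
    then have C: "C \<subseteq> A" "countable C" "\<And>U. openin X U \<Longrightarrow> x \<in> U \<Longrightarrow> finite (C - U)"
      by (auto simp: conv_ideal_def)
    have "finite (B - U)" if "openin X U" "x \<in> U" for U
      using C(3)[OF that] by (rule rev_finite_subset) (use sub in blast)
    then show "B \<in> conv_ideal X x A"
      using C(1,2) sub countable_subset[OF sub] by (auto simp: conv_ideal_def)
  qed
qed (auto simp: conv_ideal_def countable_finite Un_Diff)

section \<open>Closures in the G_delta-modification and sets of size omega_1\<close>

lemma in_closure_of_Gdelta_modification:
  "x \<in> Gdelta_modification X closure_of A \<longleftrightarrow>
     x \<in> topspace X \<and> (\<forall>G. gdelta_in X G \<and> x \<in> G \<longrightarrow> (\<exists>y\<in>A. y \<in> G))"
proof -
  have "openin (Gdelta_modification X) G" if "gdelta_in X G" for G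
    using that by (simp add: openin_Gdelta_modification arbitrary_union_of_inc)
  moreover have "\<exists>G. gdelta_in X G \<and> x \<in> G \<and> G \<subseteq> T"
    if "openin (Gdelta_modification X) T" "x \<in> T" for T
    using that by (auto simp: openin_Gdelta_modification union_of_def)
  ultimately show ?thesis
    unfolding in_closure_of topspace_Gdelta_modification by (meson subsetD)
qed

lemma countable_iff_card_of_ordLeq_natLeq: "countable A \<longleftrightarrow> |A| \<le>o natLeq"
proof -
  have "countable A \<longleftrightarrow> |A| \<le>o |UNIV :: nat set|"
    by (auto simp: countable_def simp flip: card_of_ordLeq)
  also have "\<dots> \<longleftrightarrow> |A| \<le>o natLeq"
    using card_of_nat ordIso_symmetric ordLeq_ordIso_trans by blast
  finally show ?thesis .
qed

lemma natLeq_ordLess_card_of_iff: "natLeq <o |A| \<longleftrightarrow> uncountable A"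
  by (simp add: countable_iff_card_of_ordLeq_natLeq not_ordLeq_iff_ordLess natLeq_Well_order
      card_of_Well_order)

text \<open>Being the successor of \<open>natLeq\<close>, \<open>omega1\<close> is at most the
  cardinality of \<open>Y\<close>. Since it lives on \<open>nat set\<close>, its field is carried
  into \<open>Y\<close> by an injection, whose image is the required subset.\<close>

lemma uncountable_subset_omega1:
  assumes "uncountable Y"
  obtains B where "B \<subseteq> Y" "uncountable B" "|B| \<le>o omega1"
proof -
  have iso: "|Field omega1| =o omega1"
    by (simp add: card_of_Field_ordIso cardSuc_Card_order natLeq_Card_order)
  have "omega1 \<le>o |Y|"
    using assms natLeq_ordLess_card_of_iff[of Y]
    by (simp add: cardSuc_ordLess_ordLeq[symmetric] natLeq_Card_order card_of_Card_order)
  then have "|Field omega1| \<le>o |Y|"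
    using iso ordIso_ordLeq_trans by blast
  then obtain f where f: "inj_on f (Field omega1)" "f ` Field omega1 \<subseteq> Y"
    by (auto simp flip: card_of_ordLeq)
  have "natLeq <o |Field omega1|"
    using cardSuc_greater[OF natLeq_Card_order] iso ordIso_symmetric ordLess_ordIso_trans by blast
  then have "uncountable (Field omega1)"
    by (simp add: natLeq_ordLess_card_of_iff)
  then have "uncountable (f ` Field omega1)"
    using f(1) countable_image_inj_on by blast
  moreover have "|f ` Field omega1| \<le>o omega1"
    using card_of_image iso ordLeq_ordIso_trans by blast
  ultimately show ?thesis
    using that f(2) by blast
qed

lemma gdelta_in_eq_Inter:
  assumes "gdelta_in X G"
  obtains \<U> where "countable \<U>" "\<And>U. U \<in> \<U> \<Longrightarrow> openin X U" "G = \<Inter>\<U>"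
proof -
  have "\<exists>\<U>. countable \<U> \<and> \<U> \<subseteq> Collect (openin X) \<and> topspace X \<inter> \<Inter>\<U> = G"
    using assms by (auto simp: gdelta_in_alt relative_to_def intersection_of_def)
  then obtain \<U> where "countable \<U>" "\<U> \<subseteq> Collect (openin X)" "topspace X \<inter> \<Inter>\<U> = G"
    by blast
  then show ?thesis
    \<comment> \<open>Inserting \<open>topspace X\<close> absorbs the relative intersection and
      keeps the family nonempty; the empty intersection would be the whole type.\<close>
    by (intro that[of "insert (topspace X) \<U>"]) auto
qed

lemma Gdelta_closure_of_uncountable:
  assumes "uncountable Y" "x \<in> topspace X"
    and fin: "\<And>U. openin X U \<Longrightarrow> x \<in> U \<Longrightarrow> finite (Y - U)"
  shows "x \<in> Gdelta_modification X closure_of Y"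
  unfolding in_closure_of_Gdelta_modification
proof (intro conjI allI impI)
  fix G assume G: "gdelta_in X G \<and> x \<in> G"
  obtain \<U> where \<U>: "countable \<U>" "\<And>U. U \<in> \<U> \<Longrightarrow> openin X U" "G = \<Inter>\<U>"
    using gdelta_in_eq_Inter G by metis
  have "countable (Y - U)" if "U \<in> \<U>" for U
    using that \<U> G by (intro countable_finite fin) auto
  then have "countable (\<Union>U\<in>\<U>. Y - U)"
    using \<U>(1) by (intro countable_UN) auto
  moreover have "Y - G = (\<Union>U\<in>\<U>. Y - U)"
    using \<U>(3) by auto
  ultimately have "countable (Y - G)"
    by simp
  then show "\<exists>y\<in>Y. y \<in> G"
    using assms(1) by (metis Diff_triv disjoint_iff)
qed fact

section \<open>The two alternatives of the dichotomy\<close>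

lemma Gdelta_small_closure:
  fixes X :: "'a topology"
  assumes "PID TYPE('a)" "Frechet_at X x" "alpha1_at X x"
    and A: "A \<subseteq> topspace X" and cl: "x \<in> Gdelta_modification X closure_of A"
  obtains B where "B \<subseteq> A" "|B| \<le>o omega1" "x \<in> Gdelta_modification X closure_of B"
proof -
  have x: "x \<in> topspace X"
    using cl by (simp add: in_closure_of_Gdelta_modification)
  consider
      (uncountable) Y where "Y \<subseteq> A" "uncountable Y"
        "\<And>C. C \<subseteq> Y \<Longrightarrow> countable C \<Longrightarrow> C \<in> conv_ideal X x A"
    | (union) Y :: "nat \<Rightarrow> 'a set" where "A = (\<Union>n. Y n)"
        "\<And>n Z. Z \<subseteq> Y n \<Longrightarrow> infinite Z \<Longrightarrow> Z \<notin> conv_ideal X x A"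
    using assms(1) P_ideal_conv_ideal[OF assms(3) A x] unfolding PID_def by metis
  then show ?thesis
  proof cases
    case uncountable
    obtain B where B: "B \<subseteq> Y" "uncountable B" "|B| \<le>o omega1"
      using uncountable_subset_omega1[OF uncountable(2)] .
    have "finite (B - U)" if "openin X U" "x \<in> U" for U
    proof (rule ccontr)
      assume "infinite (B - U)"
      \<comment> \<open>Such a \<open>C\<close> belongs to the ideal by the first alternative, yet
        it is infinite and lies entirely outside the neighbourhood \<open>U\<close>.\<close>
      then obtain C where C: "C \<subseteq> B - U" "countable C" "infinite C"
        using infinite_countable_subset' by blast
      have "C \<subseteq> Y"
        using B(1) C(1) by blast
      then have "C \<in> conv_ideal X x A"
        using C(2) by (rule uncountable(3))
      then have "finite (C - U)"
        using that by (auto simp: conv_ideal_def)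
      moreover have "C - U = C"
        using C by blast
      ultimately show False
        using C by simp
    qed
    then have "x \<in> Gdelta_modification X closure_of B"
      by (rule Gdelta_closure_of_uncountable[OF B(2) x])
    then show ?thesis
      using that[OF _ B(3)] B(1) uncountable(1) by (meson order_trans)
  next
    case union
    obtain n where n: "x \<in> X closure_of (Y n)"
    proof (rule ccontr)
      assume "\<not> thesis"
      then have "x \<notin> X closure_of (Y n)" for n
        using that by metis
      then have "\<forall>n. \<exists>U. openin X U \<and> x \<in> U \<and> Y n \<inter> U = {}"
        using x by (metis disjoint_iff in_closure_of)
      then obtain U where U: "\<And>n. openin X (U n)" "\<And>n. x \<in> U n" "\<And>n. Y n \<inter> U n = {}"
        by metis
      have "gdelta_in X (\<Inter>n. U n)"
        using U(1) by (intro gdelta_in_Inter) (auto intro: open_imp_gdelta_in)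
      then obtain y where "y \<in> A" "y \<in> (\<Inter>n. U n)"
        using cl U(2) unfolding in_closure_of_Gdelta_modification by blast
      then show False
        using U(3) union(1) by blast
    qed
    have "Y n \<subseteq> topspace X"
      using A union(1) by blast
    then obtain s where s: "range s \<subseteq> Y n" "convergent_to X s x"
      using assms(2) n unfolding Frechet_at_def by blast
    have "range s \<in> conv_ideal X x A"
      using range_Int_in_conv_ideal[OF s(2), of A] s(1) union(1)
      by (simp add: Int_absorb2 SUP_upper2)
    \<comment> \<open>The range lies in a single piece, and the members of the ideal inside a piece
      are finite.\<close>
    then have "finite (range s)"
      using union(2) s(1) by blast
    then obtain m where m: "infinite {k. s k = s m}"
      using pigeonhole_infinite[of UNIV s] by auto
    have nbhd: "s m \<in> U" if "openin X U" "x \<in> U" for U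
    proof -
      have "eventually (\<lambda>k. s k \<in> U) sequentially"
        using s(2) that unfolding convergent_to_def limitin_def by blast
      then have "finite {k. s k \<notin> U}"
        by (simp add: cofinite_eq_sequentially[symmetric] eventually_cofinite)
      \<comment> \<open>The value \<open>s m\<close> recurs at infinitely many indices, while only
        finitely many indices give terms outside \<open>U\<close>.\<close>
      then show ?thesis
        using m by (metis (mono_tags, lifting) finite_subset mem_Collect_eq subsetI)
    qed
    have "s m \<in> G" if "gdelta_in X G" "x \<in> G" for G
      using gdelta_in_eq_Inter[OF that(1)] that(2) nbhd by (metis InterE InterI)
    then have "x \<in> Gdelta_modification X closure_of {s m}"
      using x by (simp add: in_closure_of_Gdelta_modification)
    moreover have "|{s m}| \<le>o omega1"
    proof (rule ordLeq_transitive)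
      show "|{s m}| \<le>o natLeq"
        by (simp flip: countable_iff_card_of_ordLeq_natLeq)
      show "natLeq \<le>o omega1"
        by (intro ordLess_imp_ordLeq cardSuc_greater natLeq_Card_order)
    qed
    moreover have "{s m} \<subseteq> A"
      using s(1) union(1) by auto
    ultimately show ?thesis
      by (intro that)
  qed
qed

section \<open>From small witnesses to the tightness cardinal\<close>

text \<open>The tightness is a cardinal on \<open>'a\<close>, so \<open>\<mu>\<close> has to be cut down to that type first.\<close>

lemma card_truncate:
  fixes \<mu> :: "'b rel"
  assumes "Card_order \<mu>"
  obtains \<kappa> :: "'a rel"
  where "Card_order \<kappa>" "\<kappa> \<le>o \<mu>" "\<And>B :: 'a set. |B| \<le>o \<mu> \<Longrightarrow> |B| \<le>o \<kappa>"
\<comment> \<open>Either every subset of \<open>'a\<close> has size at most \<open>\<mu>\<close> and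
  the cardinality of the type serves as \<open>\<kappa>\<close>, or \<open>\<mu>\<close> fits into
  \<open>'a\<close> and \<open>\<kappa>\<close> is an isomorphic copy.\<close>
proof (cases "|UNIV :: 'a set| \<le>o \<mu>")
  case True
  then show ?thesis
    using that[of "|UNIV :: 'a set|"] by (simp add: card_of_mono1 card_of_Card_order)
next
  case False
  have iso: "|Field \<mu>| =o \<mu>"
    using assms by (rule card_of_Field_ordIso)
  have "\<mu> \<le>o |UNIV :: 'a set|"
    using False assms by (meson card_of_Well_order card_order_on_well_order_on ordLeq_total)
  then have "|Field \<mu>| \<le>o |UNIV :: 'a set|"
    using iso ordIso_ordLeq_trans by blast
  then obtain f :: "'b \<Rightarrow> 'a" where "inj_on f (Field \<mu>)"
    by (auto simp flip: card_of_ordLeq)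
  then have "|f ` Field \<mu>| =o \<mu>"
    using iso card_of_ordIsoI inj_on_imp_bij_betw ordIso_symmetric ordIso_transitive by metis
  then show ?thesis
    using that[of "|f ` Field \<mu>|"]
    by (meson card_of_Card_order ordIso_iff_ordLeq ordLeq_transitive)
qed

text \<open>Tightness is a minimum over cardinals on \<open>'a\<close>, whereas \<open>\<mu>\<close>
  may live on another type. The truncated \<open>\<kappa>\<close> still bounds the witnesses, so
  minimality applies to it, first at each point and then for the supremum.\<close>

lemma tightness_ordLeqI:
  fixes X :: "'a topology" and \<mu> :: "'b rel"
  assumes "Card_order \<mu>"
    and small: "\<And>x A. \<lbrakk>x \<in> topspace X; A \<subseteq> topspace X; x \<in> X closure_of A\<rbrakk>
      \<Longrightarrow> \<exists>B. B \<subseteq> A \<and> |B| \<le>o \<mu> \<and> x \<in> X closure_of B"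
  shows "tightness X \<le>o \<mu>"
proof -
  obtain \<kappa> :: "'a rel" where \<kappa>: "Card_order \<kappa>" "\<kappa> \<le>o \<mu>"
      "\<And>B :: 'a set. |B| \<le>o \<mu> \<Longrightarrow> |B| \<le>o \<kappa>"
    using card_truncate[OF assms(1)] by blast
  have "point_tightness X x \<le>o \<kappa>" if "x \<in> topspace X" for x
  proof -
    have "tight_at X x \<kappa>"
      unfolding tight_at_def using small[OF that] \<kappa>(3) by meson
    then show ?thesis
      using point_tightness_least[of X x] \<kappa>(1) by (simp add: is_least_card_def)
  qed
  then have "tightness X \<le>o \<kappa>"
    using tightness_least[of X] \<kappa>(1) by (simp add: is_least_card_def)
  then show ?thesis
    using \<kappa>(2) by (rule ordLeq_transitive)
qed

theorem theorem1:
  fixes X :: "'a topology"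
  assumes "PID TYPE('a)"
    and "Frechet_space X"
    and "alpha1_space X"
  shows "tightness (Gdelta_modification X) \<le>o omega1"
proof (rule tightness_ordLeqI)
  show "Card_order omega1"
    by (simp add: cardSuc_Card_order natLeq_Card_order)
next
  fix x A
  assume "x \<in> topspace (Gdelta_modification X)" "A \<subseteq> topspace (Gdelta_modification X)"
    and cl: "x \<in> Gdelta_modification X closure_of A"
  then have "x \<in> topspace X" "A \<subseteq> topspace X"
    by (simp_all add: topspace_Gdelta_modification)
  then show "\<exists>B. B \<subseteq> A \<and> |B| \<le>o omega1 \<and> x \<in> Gdelta_modification X closure_of B"
    using assms Gdelta_small_closure[OF assms(1) _ _ _ cl]
    unfolding Frechet_space_def alpha1_space_def by metis
qed

end
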